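(* For every non-negative even number $k$, the Jones polynomials of the pretzel links $P(k;k+4,k+3,k+5)$ and $P(k+6;k+2,k+1,k+3)$ are equal: $$V_{P(k;k+4,k+3,k+5)}=V_{P(k+6;k+2,k+1,k+3)}.$$
   Context: Pretzel links: for positive integers $p_1,\dots,p_n$, $D(p_1,\dots,p_n)$ is the standard pretzel diagram consisting of $n$ vertical columns placed from left to right, the $i$-th column being two vertical strands twisted around each other with $p_i$ crossings stacked vertically, where at every crossing the over-strand runs from lower left to upper right. For $1\le i<n$ the upper-right end of column $i$ is joined to the upper-left end of column $i+1$ and the lower-right end of column $i$ to the lower-left end of column $i+1$; the upper-left end of column $1$ is joined to the upper-right end of column $n$ by an arc passing above everything, and the lower-left end of column $1$ is joined to the lower-right end of column $n$ by an arc passing below everything. $P(p_1,\dots,p_n)$ is the link represented by $D(p_1,\dots,p_n)$. For $m\ge 0$, $D(m;p_1,\dots,p_n)$ and $P(m;p_1,\dots,p_n)$ denote $D(1,\dots,1,p_1,\dots,p_n)$ and $P(1,\dots,1,p_1,\dots,p_n)$ with $m$ initial entries equal to $1$ (so for $m=0$ these are $D(p_1,\dots,p_n)$ and $P(p_1,\dots,p_n)$). The links in the claim are (alternating) knots, so their Jones polynomials do not depend on the choice of orientation. Jones polynomial: $V_L$ is the Jones polynomial of an oriented link $L$, determined by $V_L(A^{-4})=(-A)^{-3w(D)}\langle D\rangle$, where $D$ is any diagram of $L$, $w(D)$ is its writhe and $\langle D\rangle$ is the Kauffman bracket: $\langle D\rangle=\sum_{s}A^{\sum_{c}s(c)}(-A^2-A^{-2})^{|sD|-1}$,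 the outer sum over all states $s$ (functions from the set of crossings of $D$ to $\{-1,+1\}$), the inner sum over all crossings $c$ of $D$, where $sD$ is obtained by smoothing every crossing according to $s$ and $|sD|$ is its number of closed curves. The smoothing rule: with the crossing drawn so that the over-strand runs from lower left to upper right, $s(c)=+1$ means joining the two left ends to each other and the two right ends to each other; $s(c)=-1$ means joining the two upper ends to each other and the two lower ends to each other. *)

theory Defs
  imports "HOL-Library.FuncSet" "HOL-Library.Poly_Mapping" Complex_Main
begin

section \<open>Link diagrams\<close>

text \<open>
  Every crossing is drawn (after a rotation, if necessary) with its over-strand running from lower
  left to upper right; its four ends are then the lower left, upper left, lower right and upper
  right one. A diagram is encoded by its crossings and by the arcs joining the ends of the
  crossings in pairs, each arc being listed as a pair of ends in one of its two directions.
  This determines all the data on which the Kauffman bracket and the writhe depend. In this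
  encoding every component passes through at least one crossing.
\<close>

datatype corner = LL | UL | LR | UR

type_synonym 'c strand_end = "'c \<times> corner"

record 'c diagram =
  crossings :: "'c set"
  arcs :: "('c strand_end \<times> 'c strand_end) set"

definition ends :: "'c diagram \<Rightarrow> 'c strand_end set" where
  "ends D = crossings D \<times> UNIV"

definition well_formed :: "'c diagram \<Rightarrow> bool" where
  "well_formed D \<longleftrightarrow>
     finite (crossings D) \<and>
     arcs D \<subseteq> ends D \<times> ends D \<and>
     (\<forall>e. (e, e) \<notin> arcs D) \<and>
     (\<forall>e\<in>ends D. \<exists>!f. (e, f) \<in> arcs D \<union> (arcs D)\<inverse>)"


section \<open>The Kauffman bracket\<close>

text \<open>
  Laurent polynomials with integer coefficients in \<open>A\<close> are finitely supported functions from
  exponents to coefficients, with the convolution product.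
\<close>

type_synonym laurent = "int \<Rightarrow>\<^sub>0 int"

definition A_pow :: "int \<Rightarrow> laurent" where
  "A_pow n = Poly_Mapping.single n 1"

text \<open>The power \<open>(-A)\<^sup>n\<close>, for a possibly negative \<open>n\<close>.\<close>

definition minus_A_pow :: "int \<Rightarrow> laurent" where
  "minus_A_pow n = (if even n then A_pow n else - A_pow n)"

definition states :: "'c diagram \<Rightarrow> ('c \<Rightarrow> int) set" where
  "states D = (crossings D \<rightarrow>\<^sub>E {1, -1})"

definition smoothing :: "int \<Rightarrow> (corner \<times> corner) set" where
  "smoothing \<epsilon> = (if \<epsilon> = 1 then {(LL, UL), (LR, UR)} else {(UL, UR), (LL, LR)})"

definition smoothing_arcs ::
    "'c diagram \<Rightarrow> ('c \<Rightarrow> int) \<Rightarrow> ('c strand_end \<times> 'c strand_end) set" where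
  "smoothing_arcs D s = {((c, x), (c, y)) | c x y. c \<in> crossings D \<and> (x, y) \<in> smoothing (s c)}"

text \<open>The closed curves of \<open>sD\<close>, each given as the set of ends it passes through.\<close>

definition state_curves :: "'c diagram \<Rightarrow> ('c \<Rightarrow> int) \<Rightarrow> 'c strand_end set set" where
  "state_curves D s =
     (let R = arcs D \<union> smoothing_arcs D s in ends D // (R \<union> R\<inverse>)\<^sup>*)"

definition kauffman_bracket :: "'c diagram \<Rightarrow> laurent" where
  "kauffman_bracket D =
     (\<Sum>s\<in>states D. A_pow (\<Sum>c\<in>crossings D. s c)
        * (- A_pow 2 - A_pow (-2)) ^ (card (state_curves D s) - 1))"


section \<open>Orientations, the writhe and the Jones polynomial\<close>

text \<open>
  An orientation says for each end whether the strand is directed away from the crossing there.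
  Both strands of a crossing and every arc must be directed coherently.
\<close>

definition orientation :: "'c diagram \<Rightarrow> ('c strand_end \<Rightarrow> bool) \<Rightarrow> bool" where
  "orientation D out \<longleftrightarrow>
     (\<forall>c\<in>crossings D. out (c, LL) \<noteq> out (c, UR) \<and> out (c, LR) \<noteq> out (c, UL)) \<and>
     (\<forall>(e, f)\<in>arcs D. out e \<noteq> out f)"

text \<open>
  As the over-strand runs between lower left and upper right, a crossing is positive iff
  both its strands run upwards or both run downwards.
\<close>

definition crossing_sign :: "('c strand_end \<Rightarrow> bool) \<Rightarrow> 'c \<Rightarrow> int" where
  "crossing_sign out c = (if out (c, UL) = out (c, UR) then 1 else -1)"

definition writhe :: "'c diagram \<Rightarrow> ('c strand_end \<Rightarrow> bool) \<Rightarrow> int" where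
  "writhe D out = (\<Sum>c\<in>crossings D. crossing_sign out c)"

definition normalized_bracket :: "'c diagram \<Rightarrow> ('c strand_end \<Rightarrow> bool) \<Rightarrow> laurent" where
  "normalized_bracket D out = minus_A_pow (-3 * writhe D out) * kauffman_bracket D"

text \<open>
  The Jones polynomial \<open>V\<close> in the variable \<open>t\<close>, where \<open>t = A\<^sup>-\<^sup>4\<close>, of the oriented link
  represented by a diagram. Fractional exponents of \<open>t\<close> are admitted since links with an even
  number of components involve half-integral ones.
\<close>

definition jones :: "'c diagram \<Rightarrow> ('c strand_end \<Rightarrow> bool) \<Rightarrow> (rat \<Rightarrow>\<^sub>0 int)" where
  "jones D out =
     (let F = normalized_bracket D out
      in \<Sum>n\<in>Poly_Mapping.keys F. Poly_Mapping.single (- of_int n / 4) (Poly_Mapping.lookup F n))"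

text \<open>\<open>V(A\<^sup>-\<^sup>4)\<close> is the normalized bracket: \<open>t\<^sup>q\<close> becomes \<open>A\<^sup>-\<^sup>4\<^sup>q\<close>.\<close>

lemma lookup_jones:
  "Poly_Mapping.lookup (jones D out) (- of_int n / 4) = Poly_Mapping.lookup (normalized_bracket D out) n"
proof -
  let ?F = "normalized_bracket D out"
  have "Poly_Mapping.lookup (jones D out) (- of_int n / 4) =
      (\<Sum>m\<in>Poly_Mapping.keys ?F. if m = n then Poly_Mapping.lookup ?F m else 0)"
    unfolding jones_def Let_def by (auto simp: lookup_sum lookup_single when_def intro!: sum.cong)
  also have "\<dots> = Poly_Mapping.lookup ?F n"
    by (simp add: sum.delta in_keys_iff)
  finally show ?thesis .
qed

lemma keys_jones: "Poly_Mapping.keys (jones D out) \<subseteq> range (\<lambda>n. - of_int n / 4)"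
proof
  fix q
  assume "q \<in> Poly_Mapping.keys (jones D out)"
  then have "(\<Sum>n\<in>Poly_Mapping.keys (normalized_bracket D out).
      Poly_Mapping.lookup (Poly_Mapping.single (- of_int n / 4) (Poly_Mapping.lookup (normalized_bracket D out) n)) q) \<noteq> 0"
    by (simp add: in_keys_iff jones_def Let_def lookup_sum)
  then obtain n where
    "Poly_Mapping.lookup (Poly_Mapping.single (- of_int n / 4) (Poly_Mapping.lookup (normalized_bracket D out) n)) q \<noteq> 0"
    by (meson sum.neutral)
  then have "- of_int n / 4 = q"
    by (auto simp: lookup_single when_def split: if_splits)
  then show "q \<in> range (\<lambda>n. - of_int n / 4)"
    by blast
qed


section \<open>Pretzel diagrams\<close>

text \<open>
  \<open>((i, j), x)\<close> is the end \<open>x\<close> of the \<open>j\<close>-th crossing from below in the \<open>i\<close>-th column, counting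
  from 0. The ends of column \<open>i\<close> are the upper ends of its top crossing, number \<open>ps ! i - 1\<close>, and
  the lower ends of its bottom crossing, number 0; hence the entries of \<open>ps\<close> must be positive.
\<close>

definition pretzel :: "nat list \<Rightarrow> (nat \<times> nat) diagram" where
  "pretzel ps =
     (let n = length ps; top = (\<lambda>i. (i, ps ! i - 1)); bottom = (\<lambda>i. (i, 0)) in
      \<lparr> crossings = {(i, j). i < n \<and> j < ps ! i},
        arcs =
          {(((i, j), UL), ((i, Suc j), LL)) | i j. i < n \<and> Suc j < ps ! i} \<union>
          {(((i, j), UR), ((i, Suc j), LR)) | i j. i < n \<and> Suc j < ps ! i} \<union>
          {((top i, UR), (top (Suc i), UL)) | i. Suc i < n} \<union>
          {((bottom i, LR), (bottom (Suc i), LL)) | i. Suc i < n} \<union>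
          {((top 0, UL), (top (n - 1), UR)), ((bottom 0, LL), (bottom (n - 1), LR))} \<rparr>)"

definition pretzel_ones :: "nat \<Rightarrow> nat list \<Rightarrow> (nat \<times> nat) diagram" where
  "pretzel_ones m ps = pretzel (replicate m 1 @ ps)"


section \<open>Orientations exist\<close>

lemma bipartite_involutions:
  assumes "finite E"
    and "\<And>x. x \<in> E \<Longrightarrow> a x \<in> E \<and> a x \<noteq> x \<and> a (a x) = x"
    and "\<And>x. x \<in> E \<Longrightarrow> b x \<in> E \<and> b x \<noteq> x \<and> b (b x) = x"
  shows "\<exists>f :: 'e \<Rightarrow> bool. \<forall>x\<in>E. f x \<noteq> f (a x) \<and> f x \<noteq> f (b x)"
  using assms
proof (induction "card E" arbitrary: E b rule: less_induct)
  case less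
  note a = less.prems(2) and b = less.prems(3)
  show ?case
  proof (cases "E = {}")
    case False
    then obtain x where x: "x \<in> E" by blast
    define y where "y = a x"
    define E' where "E' = E - {x, y}"
    have y: "y \<in> E" "y \<noteq> x" "a y = x" using a[OF x] by (auto simp: y_def)
    have fin: "finite E'" and card: "card E' < card E"
      using x less.prems(1) by (auto simp: E'_def intro!: psubset_card_mono)
    have a': "a z \<in> E' \<and> a z \<noteq> z \<and> a (a z) = z" if "z \<in> E'" for z
      using that a[of z] y y_def by (auto simp: E'_def)
    show ?thesis
    proof (cases "b x = y")
      case True
      have b': "b z \<in> E' \<and> b z \<noteq> z \<and> b (b z) = z" if "z \<in> E'" for z
        using that b[of z] b[OF x] b[OF y(1)] True by (auto simp: E'_def)
      from less.hyps[OF card fin a' b'] obtain f :: "'e \<Rightarrow> bool"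
        where f: "\<forall>z\<in>E'. f z \<noteq> f (a z) \<and> f z \<noteq> f (b z)" by auto
      let ?f = "f(x := True, y := False)"
      have "?f z \<noteq> ?f (a z) \<and> ?f z \<noteq> ?f (b z)" if "z \<in> E" for z
      proof (cases "z \<in> E'")
        case z: True
        have "?f w = f w" if "w \<in> E'" for w
          using that by (auto simp: E'_def)
        then show ?thesis using f z a'[OF z] b'[OF z] by metis
      next
        case z: False
        then have "z = x \<or> z = y" using that by (auto simp: E'_def)
        then show ?thesis using y y_def True b[OF x] by auto
      qed
      then show ?thesis by blast
    next
      case False
      define u where "u = b x"
      define v where "v = b y"
      have u: "u \<in> E'" "b u = x" "v \<in> E'" "b v = y" "u \<noteq> v"
        using b[OF x] b[OF y(1)] False y(2) by (auto simp: u_def v_def E'_def)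
      define b1 where "b1 = b(u := v, v := u)"
      have b': "b1 z \<in> E' \<and> b1 z \<noteq> z \<and> b1 (b1 z) = z" if z: "z \<in> E'" for z
      proof (cases "z = u \<or> z = v")
        case True
        then show ?thesis using u by (auto simp: b1_def)
      next
        case zuv: False
        have zE: "z \<in> E" "z \<noteq> x" "z \<noteq> y" using z by (auto simp: E'_def)
        have "b z \<noteq> u" "b z \<noteq> v" "b z \<noteq> x" "b z \<noteq> y"
          using zE zuv b[OF zE(1)] u u_def v_def by metis+
        moreover have "b1 z = b z"
          using zuv by (simp add: b1_def)
        ultimately show ?thesis using b[OF zE(1)] by (simp add: b1_def E'_def)
      qed
      from less.hyps[OF card fin a' b'] obtain f :: "'e \<Rightarrow> bool"
        where f: "\<forall>z\<in>E'. f z \<noteq> f (a z) \<and> f z \<noteq> f (b1 z)" by auto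
      have "b1 u = v" using u(5) by (simp add: b1_def)
      then have fuv: "f u \<noteq> f v" using f u(1) by metis
      let ?f = "f(x := \<not> f u, y := \<not> f v)"
      have ne: "u \<noteq> x" "u \<noteq> y" "v \<noteq> x" "v \<noteq> y" using u by (auto simp: E'_def)
      have "?f z \<noteq> ?f (a z) \<and> ?f z \<noteq> ?f (b z)" if "z \<in> E" for z
      proof (cases "z \<in> E'")
        case z: True
        have f': "?f w = f w" if "w \<in> E'" for w
          using that by (auto simp: E'_def)
        have 1: "?f z \<noteq> ?f (a z)" using f f' z a'[OF z] by metis
        have 2: "?f z \<noteq> ?f (b z)"
        proof (cases "z = u \<or> z = v")
          case True
          then show ?thesis using u(2,4) ne y(2) by auto
        next
          case zuv: False
          then have "b1 z = b z" by (simp add: b1_def)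
          then show ?thesis using f f' z b'[OF z] by metis
        qed
        from 1 2 show ?thesis by blast
      next
        case z: False
        then have "z = x \<or> z = y" using that by (auto simp: E'_def)
        then show ?thesis using y y_def u_def v_def ne fuv by auto
      qed
      then show ?thesis by blast
    qed
  qed auto
qed

lemma well_formed_imp_orientation:
  assumes "well_formed D"
  shows "\<exists>out. orientation D out"
proof -
  let ?R = "arcs D \<union> (arcs D)\<inverse>"
  define a where "a e = (THE f. (e, f) \<in> ?R)" for e
  define b :: "'a strand_end \<Rightarrow> 'a strand_end" where
    "b e = (fst e, case snd e of LL \<Rightarrow> UR | UR \<Rightarrow> LL | UL \<Rightarrow> LR | LR \<Rightarrow> UL)" for e
  have uniq: "\<exists>!f. (e, f) \<in> ?R" if "e \<in> ends D" for e
    using assms that unfolding well_formed_def by blast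
  have R: "(e, a e) \<in> ?R" if "e \<in> ends D" for e
    unfolding a_def by (rule theI'[OF uniq[OF that]])
  have aI: "a e = f" if "(e, f) \<in> ?R" "e \<in> ends D" for e f
    using uniq[OF that(2)] R[OF that(2)] that(1) by blast
  have sub: "e \<in> ends D \<and> f \<in> ends D \<and> e \<noteq> f" if "(e, f) \<in> ?R" for e f
    using assms that unfolding well_formed_def by blast
  have UN: "(UNIV :: corner set) = {LL, UL, LR, UR}"
    using corner.exhaust by auto
  have fin: "finite (ends D)"
    using assms by (simp add: ends_def well_formed_def UN)
  have A: "a e \<in> ends D \<and> a e \<noteq> e \<and> a (a e) = e" if "e \<in> ends D" for e
    using R[OF that] sub[OF R[OF that]] aI[of "a e" e] by auto
  have B: "b e \<in> ends D \<and> b e \<noteq> e \<and> b (b e) = e" if "e \<in> ends D" for e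
    using that by (cases e; cases "snd e") (auto simp: b_def ends_def)
  obtain out :: "'a strand_end \<Rightarrow> bool"
    where out: "\<forall>e\<in>ends D. out e \<noteq> out (a e) \<and> out e \<noteq> out (b e)"
    using bipartite_involutions[OF fin A B] by blast
  have "out e \<noteq> out f" if "(e, f) \<in> arcs D" for e f
    using that out sub[of e f] aI[of e f] by auto
  moreover have "out (c, LL) \<noteq> out (c, UR) \<and> out (c, LR) \<noteq> out (c, UL)"
    if "c \<in> crossings D" for c
  proof -
    have "(c, LL) \<in> ends D" "(c, LR) \<in> ends D" using that by (auto simp: ends_def)
    then show ?thesis using out by (fastforce simp: b_def)
  qed
  ultimately have "orientation D out" by (auto simp: orientation_def)
  then show ?thesis by blast
qed

lemma well_formed_pretzel:
  assumes "ps \<noteq> []" and pos: "\<And>p. p \<in> set ps \<Longrightarrow> 0 < p"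
  shows "well_formed (pretzel ps)"
proof -
  define n where "n = length ps"
  have n: "0 < n" using assms(1) by (simp add: n_def)
  have p: "0 < ps ! i" if "i < n" for i
    using pos that by (simp add: n_def)
  have fin: "finite (crossings (pretzel ps))"
  proof (rule finite_subset)
    show "crossings (pretzel ps) \<subseteq> (SIGMA i:{..<length ps}. {..<ps ! i})"
      by (auto simp: pretzel_def Let_def)
  qed auto
  have sub: "arcs (pretzel ps) \<subseteq> ends (pretzel ps) \<times> ends (pretzel ps)"
    using p n by (auto simp: pretzel_def Let_def ends_def n_def)
  have irr: "(e, e) \<notin> arcs (pretzel ps)" for e
    by (auto simp: pretzel_def Let_def)
  have ex: "\<exists>!f. (e, f) \<in> arcs (pretzel ps) \<union> (arcs (pretzel ps))\<inverse>"
    if e: "e \<in> ends (pretzel ps)" for e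
  proof -
    obtain i j x where ij: "e = ((i, j), x)" "i < n" "j < ps ! i"
      using e by (cases e) (auto simp: ends_def pretzel_def Let_def n_def)
    let ?P = "\<lambda>f. (e, f) \<in> arcs (pretzel ps) \<union> (arcs (pretzel ps))\<inverse>"
    note d = pretzel_def Let_def ij(1) n_def[symmetric]
    show ?thesis
    proof (cases x)
      case UL
      show ?thesis
      proof (cases "Suc j < ps ! i")
        case True
        then show ?thesis using ij UL by (intro ex1I[of ?P "((i, Suc j), LL)"]) (auto simp: d)
      next
        case F: False
        then have j: "j = ps ! i - 1" using ij by simp
        show ?thesis
        proof (cases i)
          case 0
          then show ?thesis using ij UL j
            by (intro ex1I[of ?P "((n - 1, ps ! (n - 1) - 1), UR)"]) (auto simp: d)
        next
          case (Suc i')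
          then show ?thesis using ij UL j
            by (intro ex1I[of ?P "((i', ps ! i' - 1), UR)"]) (auto simp: d)
        qed
      qed
    next
      case UR
      show ?thesis
      proof (cases "Suc j < ps ! i")
        case True
        then show ?thesis using ij UR by (intro ex1I[of ?P "((i, Suc j), LR)"]) (auto simp: d)
      next
        case F: False
        then have j: "j = ps ! i - 1" using ij by simp
        show ?thesis
        proof (cases "Suc i < n")
          case False
          then have "i = n - 1" using ij by simp
          then show ?thesis using ij UR j
            by (intro ex1I[of ?P "((0, ps ! 0 - 1), UL)"]) (auto simp: d)
        next
          case True
          then show ?thesis using ij UR j
            by (intro ex1I[of ?P "((Suc i, ps ! Suc i - 1), UL)"]) (auto simp: d)
        qed
      qed
    next
      case LL
      show ?thesis
      proof (cases j)
        case (Suc j')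
        then show ?thesis using ij LL by (intro ex1I[of ?P "((i, j'), UL)"]) (auto simp: d)
      next
        case j: 0
        show ?thesis
        proof (cases i)
          case 0
          then show ?thesis using ij LL j
            by (intro ex1I[of ?P "((n - 1, 0), LR)"]) (auto simp: d)
        next
          case (Suc i')
          then show ?thesis using ij LL j
            by (intro ex1I[of ?P "((i', 0), LR)"]) (auto simp: d)
        qed
      qed
    next
      case LR
      show ?thesis
      proof (cases j)
        case (Suc j')
        then show ?thesis using ij LR by (intro ex1I[of ?P "((i, j'), UR)"]) (auto simp: d)
      next
        case j: 0
        show ?thesis
        proof (cases "Suc i < n")
          case False
          then have "i = n - 1" using ij by simp
          then show ?thesis using ij LR j
            by (intro ex1I[of ?P "((0, 0), LL)"]) (auto simp: d)
        next
          case True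
          then show ?thesis using ij LR j
            by (intro ex1I[of ?P "((Suc i, 0), LL)"]) (auto simp: d)
        qed
      qed
    qed
  qed
  show ?thesis
    unfolding well_formed_def using fin sub irr ex by blast
qed

lemma pretzel_ones_orientation:
  assumes "ps \<noteq> []" and "\<And>p. p \<in> set ps \<Longrightarrow> 0 < p"
  shows "\<exists>out. orientation (pretzel_ones m ps) out"
  unfolding pretzel_ones_def
  using assms by (intro well_formed_imp_orientation well_formed_pretzel) auto

end

theory Submission
  imports Defs
begin

text \<open>
  Write \<open>\<delta> = -A\<^sup>2 - A\<^sup>-\<^sup>2\<close>. The equality of the two Jones polynomials comes from a closed formula for the
  Kauffman bracket of an arbitrary pretzel diagram, evaluated at the two parameter lists.

  Smooth all crossings of \<open>D(p\<^sub>1,\<dots>,p\<^sub>n)\<close> and let \<open>b\<^sub>i\<close> be the number of horizontally smoothed crossings in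
  column \<open>i\<close>. A column with \<open>b\<^sub>i = 0\<close> consists of two vertical strands; a column with \<open>b\<^sub>i > 0\<close> is closed off
  by a cap and a cup and contains \<open>b\<^sub>i - 1\<close> small loops in between. If \<open>v\<close> columns have \<open>b\<^sub>i = 0\<close>, then
  outside the small loops there are \<open>v\<close> curves, one between any two cyclically consecutive such columns;
  only for \<open>v = 0\<close> the number is 2, namely one curve above and one below the columns. This is lemma
  \<open>card_state_curves\<close>. With \<open>\<delta>\<^sup>v\<close> in place of the correct power for \<open>v = 0\<close> the state sum would be a
  product over the columns, and the exception is corrected by a second product, over the states with
  \<open>v = 0\<close>. Both column sums are binomial expansions, so \<open>\<delta>\<^sup>n\<^sup>+\<^sup>1\<langle>D\<rangle>\<close> equals
    \<open>\<Prod>\<^sub>i ((-A\<^sup>-\<^sup>3)^p\<^sub>i + (\<delta>\<^sup>2 - 1) A^p\<^sub>i) + (\<delta>\<^sup>2 - 1) \<Prod>\<^sub>i ((-A\<^sup>-\<^sup>3)^p\<^sub>i - A^p\<^sub>i)\<close>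
  (\<open>loop_times_kauffman_bracket_pretzel\<close> with \<open>loop_times_capped_sum\<close> and \<open>closed_sum_eq\<close>).
  A column with a single crossing contributes the monomials \<open>-A\<^sup>3\<close> and \<open>A\<^sup>-\<^sup>1\<close> to the two products, after
  division by \<open>\<delta>\<close>. Hence the two brackets of the theorem are explicit polynomials in \<open>A\<close>, \<open>A\<^sup>k\<close> and their
  inverses, and expanding them shows that the second is \<open>A\<^sup>1\<^sup>2\<close> times the first
  (\<open>kauffman_bracket_relation\<close>).

  That factor is what the writhe removes. If exactly one column has an even number of crossings and the
  number of columns is odd, every orientation makes the two strands of the even column antiparallel
  and those of the odd columns parallel, so the writhe is the number of crossings in odd columns minus
  that in the even column (\<open>writhe_one_even_column\<close>). The writhes are \<open>2k + 4\<close> and \<open>2k + 8\<close>, so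
  the normalizing factor \<open>(-A)\<^sup>-\<^sup>3\<^sup>w\<close> of the first diagram is \<open>A\<^sup>1\<^sup>2\<close> times that of the second.
\<close>

section \<open>Counting below a position\<close>

primrec num_below :: "(nat \<Rightarrow> bool) \<Rightarrow> nat \<Rightarrow> nat" where
  "num_below P 0 = 0"
| "num_below P (Suc n) = num_below P n + of_bool (P n)"

lemma num_below_mono: "m \<le> n \<Longrightarrow> num_below P m \<le> num_below P n"
  by (induction n rule: dec_induct) auto

lemma num_below_attained:
  assumes "c < num_below P n"
  obtains j where "j < n" "P j" "num_below P j = c"
proof -
  have "\<exists>j<n. P j \<and> num_below P j = c"
    using assms
  proof (induction n)
    case (Suc n)
    show ?case
    proof (cases "c < num_below P n")
      case True
      then show ?thesis using Suc.IH less_SucI by blast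
    next
      case False
      then have "P n" "num_below P n = c"
        using Suc.prems by (cases "P n"; simp)+
      then show ?thesis by blast
    qed
  qed simp
  then show ?thesis using that by blast
qed

lemma num_below_pos_iff: "0 < num_below P n \<longleftrightarrow> (\<exists>j<n. P j)"
  by (induction n) (auto simp: less_Suc_eq)

lemma num_below_eq_sum: "num_below P n = (\<Sum>j<n. of_bool (P j))"
  by (induction n) auto

text \<open>
  Used both inside a column, where steps past a vertical smoothing stay on a curve, and along the
  row of columns, where steps past a column with a horizontal smoothing do.
\<close>

lemma steps_where_num_below_constant:
  assumes "m \<le> n" "num_below P m = num_below P n"
    and "\<And>a. r a a"
    and "\<And>a b c. r a b \<Longrightarrow> r b c \<Longrightarrow> r a c"
    and "\<And>j. j < n \<Longrightarrow> \<not> P j \<Longrightarrow> r (f j) (f (Suc j))"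
  shows "r (f m) (f n)"
  using assms(1,2,5)
proof (induction n rule: dec_induct)
  case (step n)
  have "num_below P m \<le> num_below P n"
    using step.hyps by (intro num_below_mono) auto
  then have "num_below P m = num_below P n" "\<not> P n"
    using step.prems(1) by (auto split: if_splits)
  then show ?case using step assms(4) by (meson less_Suc_eq lessI)
qed (simp add: assms(3))


section \<open>The closed curves of a state of a pretzel diagram\<close>

lemma card_image_cong_kernel:
  assumes "\<And>x y. x \<in> E \<Longrightarrow> y \<in> E \<Longrightarrow> F x = F y \<longleftrightarrow> G x = G y"
  shows "card (F ` E) = card (G ` E)"
proof -
  let ?h = "\<lambda>z. F (inv_into E G z)"
  have h: "?h (G x) = F x" if "x \<in> E" for x
    using assms[of "inv_into E G (G x)" x] that by (simp add: inv_into_into f_inv_into_f)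
  have "inj_on ?h (G ` E)"
    by (rule inj_onI) (use h assms in auto)
  moreover have "F ` E = ?h ` (G ` E)"
    using h by force
  ultimately show ?thesis
    by (metis card_image)
qed

text \<open>
  Components are counted by a complete invariant: a labelling that is constant along the
  generating relation and separates different components.
\<close>

lemma card_connected_components:
  assumes resp: "\<And>e f. (e, f) \<in> R \<Longrightarrow> label e = label f"
    and conn: "\<And>e f. e \<in> E \<Longrightarrow> f \<in> E \<Longrightarrow> label e = label f \<Longrightarrow> (e, f) \<in> (R \<union> R\<inverse>)\<^sup>*"
  shows "card (E // (R \<union> R\<inverse>)\<^sup>*) = card (label ` E)"
proof -
  let ?C = "(R \<union> R\<inverse>)\<^sup>*"
  have eq: "label e = label f" if "(e, f) \<in> ?C" for e f
    using that by (induction rule: rtrancl_induct) (auto dest: resp)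
  have "?C `` {e} = ?C `` {f} \<longleftrightarrow> label e = label f" if "e \<in> E" "f \<in> E" for e f
  proof
    assume "?C `` {e} = ?C `` {f}"
    then have "(f, e) \<in> ?C" by blast
    then show "label e = label f" by (simp add: eq)
  next
    assume "label e = label f"
    then have "(e, f) \<in> ?C" "(f, e) \<in> ?C" using conn that by auto
    then show "?C `` {e} = ?C `` {f}" by (auto intro: rtrancl_trans)
  qed
  moreover have "E // ?C = (\<lambda>e. ?C `` {e}) ` E"
    by (auto simp: quotient_def)
  ultimately show ?thesis
    using card_image_cong_kernel[of E "\<lambda>e. ?C `` {e}" label] by simp
qed

lemma crossings_pretzel: "crossings (pretzel ps) = (SIGMA i:{..<length ps}. {..<ps ! i})"
  by (auto simp: pretzel_def Let_def)

locale pretzel_columns =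
  fixes ps :: "nat list"
  assumes nonempty: "ps \<noteq> []" and pos: "\<And>p. p \<in> set ps \<Longrightarrow> 0 < p"
begin

abbreviation "n \<equiv> length ps"

lemma n_pos: "0 < n"
  using nonempty by simp

lemma p_pos: "i < n \<Longrightarrow> 0 < ps ! i"
  using pos by simp

end

locale pretzel_state = pretzel_columns +
  fixes s :: "nat \<times> nat \<Rightarrow> int"
begin

text \<open>
  The caps and cups of a column come from its horizontal smoothings. The smoothing rule treats every
  value other than 1 like \<open>-1\<close>, hence the test for \<open>\<noteq> 1\<close>.
\<close>

definition caps :: "nat \<Rightarrow> nat \<Rightarrow> nat" where
  "caps i a = num_below (\<lambda>j. s (i, j) \<noteq> 1) a"

abbreviation "col_caps i \<equiv> caps i (ps ! i)"

text \<open>Two strands pass from the bottom to the top through exactly those columns that have no horizontal smoothing.\<close>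

definition through :: "nat \<Rightarrow> nat" where
  "through g = num_below (\<lambda>i. col_caps i = 0) g"

definition joins :: "((nat \<times> nat) strand_end \<times> (nat \<times> nat) strand_end) set" where
  "joins = arcs (pretzel ps) \<union> smoothing_arcs (pretzel ps) s"

definition same_curve :: "(nat \<times> nat) strand_end \<Rightarrow> (nat \<times> nat) strand_end \<Rightarrow> bool" where
  "same_curve e f \<longleftrightarrow> (e, f) \<in> (joins \<union> joins\<inverse>)\<^sup>*"

lemma caps_Suc: "caps i (Suc a) = caps i a + of_bool (s (i, a) \<noteq> 1)"
  by (simp add: caps_def)

lemma caps_le: "a \<le> ps ! i \<Longrightarrow> caps i a \<le> col_caps i"
  unfolding caps_def by (rule num_below_mono)

lemma caps_0: "caps i 0 = 0"
  by (simp add: caps_def)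

lemma through_Suc: "through (Suc g) = through g + of_bool (col_caps g = 0)"
  by (simp add: through_def)

lemma through_0: "through 0 = 0"
  by (simp add: through_def)

lemma through_le: "g \<le> n \<Longrightarrow> through g \<le> through n"
  unfolding through_def by (rule num_below_mono)

lemma same_curve_refl: "same_curve e e"
  by (simp add: same_curve_def)

lemma same_curve_trans [trans]: "same_curve e f \<Longrightarrow> same_curve f g \<Longrightarrow> same_curve e g"
  unfolding same_curve_def by (rule rtrancl_trans)

lemma same_curve_sym: "same_curve e f \<Longrightarrow> same_curve f e"
  unfolding same_curve_def
  by (rule symD[OF sym_rtrancl[OF sym_Un_converse]])

lemma same_curveI: "(e, f) \<in> joins \<Longrightarrow> same_curve e f"
  by (auto simp: same_curve_def)

subsection \<open>Labels\<close>

fun height :: "nat \<Rightarrow> corner \<Rightarrow> nat" where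
  "height j UL = Suc j" | "height j UR = Suc j" | "height j LL = j" | "height j LR = j"

text \<open>
  Gap \<open>g\<close> lies to the left of column \<open>g\<close>; gap \<open>n\<close>, to the right of the last column, is glued to gap 0 by
  the two outer arcs.
\<close>

fun gap_index :: "nat \<Rightarrow> corner \<Rightarrow> nat" where
  "gap_index i UL = i" | "gap_index i LL = i" | "gap_index i UR = Suc i" | "gap_index i LR = Suc i"

text \<open>
  The label \<open>(i, c)\<close> with \<open>c > 0\<close> names the small loop between the \<open>c\<close>-th and the next horizontal smoothing
  of column \<open>i\<close>. The other curves get labels \<open>(c, 0)\<close>: without columns of two vertical strands, \<open>c\<close>
  tells the lower curve from the upper one; otherwise \<open>c\<close> counts such columns to the left, modulo
  their total number because gap \<open>n\<close> is glued to gap 0.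
\<close>

fun label :: "(nat \<times> nat) strand_end \<Rightarrow> nat \<times> nat" where
  "label ((i, j), x) =
     (let c = caps i (height j x) in
      if 0 < c \<and> c < col_caps i then (i, c)
      else if through n = 0 then (of_bool (c \<noteq> 0), 0)
      else (through (gap_index i x) mod through n, 0))"

lemma caps_pos_of_minus:
  assumes "i < n" "j < ps ! i" "s (i, j) \<noteq> 1"
  shows "0 < col_caps i"
  using assms by (auto simp: caps_def num_below_pos_iff)

lemma col_caps_pos_if_through_0:
  assumes "through n = 0" "i < n"
  shows "0 < col_caps i"
  using assms num_below_pos_iff[of "\<lambda>i. col_caps i = 0" n] by (auto simp: through_def)

lemma label_joins:
  assumes "(e, f) \<in> joins"
  shows "label e = label f"
proof -
  consider
      (arc) "(e, f) \<in> arcs (pretzel ps)"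
    | (smooth) i j x y where "e = ((i, j), x)" "f = ((i, j), y)" "i < n" "j < ps ! i"
        "(x, y) \<in> smoothing (s (i, j))"
    using assms by (auto simp: joins_def smoothing_arcs_def pretzel_def Let_def)
  then show ?thesis
  proof cases
    case arc
    have last: "Suc (ps ! i - Suc 0) = ps ! i" if "i < n" for i
      using p_pos[OF that] by simp
    note p = p_pos[OF n_pos] p_pos[of "n - Suc 0"]
    show ?thesis
      using arc n_pos last p by (auto simp: pretzel_def Let_def caps_0 through_0 col_caps_pos_if_through_0)
  next
    case smooth
    show ?thesis
    proof (cases "s (i, j) = 1")
      case True
      then show ?thesis using smooth by (auto simp: smoothing_def caps_Suc Let_def)
    next
      case False
      then show ?thesis using smooth caps_pos_of_minus[OF smooth(3,4) False]
        by (auto simp: smoothing_def through_Suc Let_def)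
    qed
  qed
qed

subsection \<open>Ends with equal labels lie on the same curve\<close>

text \<open>
  Every end lies on a common curve with the node at its height on its side of the column, by at most one
  vertical arc (\<open>end_same_curve_node\<close>). Following a strand upwards thus means increasing one
  number from 0 to the number of crossings of the column; only the top node is an upper end.
\<close>

definition node :: "nat \<Rightarrow> nat \<Rightarrow> bool \<Rightarrow> (nat \<times> nat) strand_end" where
  "node i a right =
     (if a < ps ! i then ((i, a), if right then LR else LL)
      else ((i, ps ! i - 1), if right then UR else UL))"

definition level :: "bool \<Rightarrow> nat \<Rightarrow> nat" where
  "level upper i = (if upper then ps ! i else 0)"

text \<open>
  Ends at the lower or upper arc in a gap. In gap \<open>n\<close> there is no column to the right, so its
  representative is taken from the last column.
\<close>

definition gap :: "bool \<Rightarrow> nat \<Rightarrow> (nat \<times> nat) strand_end" where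
  "gap upper g = (if g < n then node g (level upper g) False else node (n - 1) (level upper (n - 1)) True)"

lemma end_same_curve_node:
  assumes "i < n" "j < ps ! i"
  shows "same_curve ((i, j), x) (node i (height j x) (x \<in> {UR, LR}))"
proof (cases "x \<in> {UL, UR} \<and> Suc j < ps ! i")
  case True
  then have "(((i, j), x), node i (height j x) (x \<in> {UR, LR})) \<in> joins"
    using assms by (auto simp: joins_def pretzel_def Let_def node_def)
  then show ?thesis by (rule same_curveI)
next
  case False
  then have "node i (height j x) (x \<in> {UR, LR}) = ((i, j), x)"
    using assms by (cases x) (auto simp: node_def)
  then show ?thesis by (simp add: same_curve_refl)
qed

lemma smoothing_same_curve:
  assumes "i < n" "j < ps ! i" "(x, y) \<in> smoothing (s (i, j))"
  shows "same_curve (node i (height j x) (x \<in> {UR, LR})) (node i (height j y) (y \<in> {UR, LR}))"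
proof -
  have "(((i, j), x), ((i, j), y)) \<in> joins"
    using assms by (auto simp: joins_def smoothing_arcs_def pretzel_def Let_def)
  then show ?thesis
    using end_same_curve_node[OF assms(1,2)]
    by (meson same_curveI same_curve_sym same_curve_trans)
qed

lemma vertical_smoothing_same_curve:
  assumes "i < n" "j < ps ! i" "s (i, j) = 1"
  shows "same_curve (node i j right) (node i (Suc j) right)"
  using smoothing_same_curve[OF assms(1,2), of LL UL] smoothing_same_curve[OF assms(1,2), of LR UR] assms(3)
  by (cases right) (auto simp: smoothing_def)

lemma horizontal_smoothing_same_curve:
  assumes "i < n" "j < ps ! i" "s (i, j) \<noteq> 1" "a \<in> {j, Suc j}"
  shows "same_curve (node i a False) (node i a True)"
  using smoothing_same_curve[OF assms(1,2), of LL LR] smoothing_same_curve[OF assms(1,2), of UL UR] assms(3,4)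
  by (auto simp: smoothing_def)

lemma same_caps_same_curve:
  assumes "i < n" "a \<le> ps ! i" "b \<le> ps ! i" "caps i a = caps i b"
  shows "same_curve (node i a right) (node i b right)"
proof -
  have *: "same_curve (node i a right) (node i b right)"
    if "a \<le> b" "b \<le> ps ! i" "caps i a = caps i b" for a b
  proof (rule steps_where_num_below_constant[where f = "\<lambda>a. node i a right"])
    show "num_below (\<lambda>j. s (i, j) \<noteq> 1) a = num_below (\<lambda>j. s (i, j) \<noteq> 1) b"
      using that(3) by (simp add: caps_def)
    show "same_curve (node i j right) (node i (Suc j) right)" if "j < b" "\<not> s (i, j) \<noteq> 1" for j
      using vertical_smoothing_same_curve[OF assms(1)] that \<open>b \<le> ps ! i\<close> by simp
  qed (fact \<open>a \<le> b\<close> same_curve_refl same_curve_trans)+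
  show ?thesis
    using *[of a b] *[of b a] assms by (metis same_curve_sym nat_le_linear)
qed

text \<open>
  In a column with a horizontal smoothing every region is bounded by one below or above it, and
  that smoothing joins the left and the right strand of the region.
\<close>

lemma sides_same_curve:
  assumes "i < n" "a \<le> ps ! i" "0 < col_caps i"
  shows "same_curve (node i a left) (node i a right)"
proof -
  \<comment> \<open>The bounding smoothing is the last one below if there is one, and otherwise the first one above.\<close>
  obtain j b where j: "j < ps ! i" "s (i, j) \<noteq> 1" "b \<in> {j, Suc j}" "caps i b = caps i a"
  proof (cases "caps i a")
    case 0
    then have "caps i a < num_below (\<lambda>j. s (i, j) \<noteq> 1) (ps ! i)"
      using assms(3) by (simp add: caps_def)
    then show ?thesis
      using that by (elim num_below_attained) (auto simp: caps_def)
  next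
    case (Suc c)
    then have "c < num_below (\<lambda>j. s (i, j) \<noteq> 1) a" by (simp add: caps_def)
    then obtain j where "j < a" "s (i, j) \<noteq> 1" "caps i j = c"
      by (elim num_below_attained) (auto simp: caps_def)
    then show ?thesis
      using that[of j "Suc j"] assms(2) Suc by (auto simp: caps_Suc)
  qed
  then have "same_curve (node i a False) (node i b False)" "same_curve (node i b True) (node i a True)"
    using assms by (auto intro!: same_caps_same_curve)
  moreover have "same_curve (node i b False) (node i b True)"
    using horizontal_smoothing_same_curve[OF assms(1) j(1,2,3)] .
  ultimately have "same_curve (node i a False) (node i a True)"
    by (meson same_curve_trans)
  then show ?thesis
    by (cases left; cases right) (auto intro: same_curve_refl same_curve_sym)
qed

lemma level_le: "level upper i \<le> ps ! i"
  by (simp add: level_def)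

lemma gap_wrap: "same_curve (gap upper 0) (gap upper n)"
  using p_pos[OF n_pos] p_pos[of "n - 1"] n_pos
  by (intro same_curveI)
    (auto simp: gap_def node_def level_def joins_def pretzel_def Let_def)

lemma node_gap:
  assumes "i < n"
  shows "same_curve (node i (level upper i) right) (gap upper (if right then Suc i else i))"
proof (cases "right \<and> Suc i < n")
  case True
  then have "(node i (level upper i) right, gap upper (Suc i)) \<in> joins"
    using p_pos[OF assms] p_pos[of "Suc i"]
    by (auto simp: gap_def node_def level_def joins_def pretzel_def Let_def)
  then show ?thesis using True same_curveI by simp
next
  case False
  then have "node i (level upper i) right = gap upper (if right then Suc i else i)"
    using assms Suc_diff_1[OF n_pos] by (auto simp: gap_def dest: less_antisym)
  then show ?thesis by (simp add: same_curve_refl)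
qed

lemma gap_across:
  assumes "i < n" "0 < col_caps i"
  shows "same_curve (gap upper i) (gap upper (Suc i))"
proof -
  have "same_curve (gap upper i) (node i (level upper i) False)"
    using node_gap[OF assms(1), of upper False] by (simp add: same_curve_sym)
  also have "same_curve (node i (level upper i) False) (node i (level upper i) True)"
    by (rule sides_same_curve[OF assms(1) level_le assms(2)])
  also have "same_curve (node i (level upper i) True) (gap upper (Suc i))"
    using node_gap[OF assms(1), of upper True] by simp
  finally show ?thesis .
qed

text \<open>In a column without horizontal smoothing the left strand runs from the upper to the lower arc.\<close>

lemma gap_vertical:
  assumes "i < n" "col_caps i = 0"
  shows "same_curve (gap upper i) (gap upper' i)"
proof -
  have "caps i (level upper i) = caps i (level upper' i)"
    using assms(2) by (auto simp: level_def caps_0)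
  then show ?thesis
    using same_caps_same_curve[OF assms(1) level_le level_le] assms(1) by (simp add: gap_def)
qed

lemma same_through_same_curve:
  assumes "g \<le> n" "h \<le> n" "through g = through h"
  shows "same_curve (gap upper g) (gap upper h)"
proof -
  have *: "same_curve (gap upper g) (gap upper h)"
    if "g \<le> h" "h \<le> n" "through g = through h" for g h
  proof (rule steps_where_num_below_constant[where f = "\<lambda>g. gap upper g"])
    show "num_below (\<lambda>i. col_caps i = 0) g = num_below (\<lambda>i. col_caps i = 0) h"
      using that(3) by (simp add: through_def)
    show "same_curve (gap upper j) (gap upper (Suc j))" if "j < h" "\<not> col_caps j = 0" for j
      using gap_across that \<open>h \<le> n\<close> by simp
  qed (fact \<open>g \<le> h\<close> same_curve_refl same_curve_trans)+
  show ?thesis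
    using *[of g h] *[of h g] assms by (metis same_curve_sym nat_le_linear)
qed

text \<open>
  The gaps with the same label up to the gluing are all joined to a column of two vertical strands at the
  right end of the group, which also joins their upper and lower arcs to each other.
\<close>

lemma gap_same_curve_through_column:
  assumes "g \<le> n" "i < n" "col_caps i = 0" "through g mod through n = through i"
  shows "same_curve (gap upper g) (gap upper' i)"
proof -
  have "same_curve (gap upper g) (gap upper i)"
  proof (cases "through g = through n")
    case True
    then have "through i = 0" using assms(4) by simp
    then show ?thesis
      using True assms(1,2) same_through_same_curve[of g n upper] same_through_same_curve[of 0 i upper]
        gap_wrap[of upper]
      by (simp add: through_0) (meson same_curve_sym same_curve_trans)
  next
    case False
    then have "through g < through n" using through_le[OF assms(1)] by simp
    then show ?thesis using assms by (intro same_through_same_curve) auto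
  qed
  then show ?thesis
    using gap_vertical[OF assms(2,3)] same_curve_trans by blast
qed

lemma outer_end_same_curve_gap:
  assumes "i < n" "j < ps ! i" and outer: "\<not> (0 < caps i (height j x) \<and> caps i (height j x) < col_caps i)"
  shows "same_curve ((i, j), x) (gap (caps i (height j x) \<noteq> 0) (gap_index i x))"
proof -
  let ?c = "caps i (height j x)"
  let ?upper = "?c \<noteq> 0"
  let ?right = "x \<in> {UR, LR}"
  have h: "height j x \<le> ps ! i" using assms(2) by (cases x) auto
  have "?c = caps i (level ?upper i)"
    using outer caps_le[OF h] by (auto simp: level_def caps_0)
  then have level: "same_curve (node i (height j x) ?right) (node i (level ?upper i) ?right)"
    by (intro same_caps_same_curve assms h level_le)
  have side: "(if ?right then Suc i else i) = gap_index i x"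
    by (cases x) auto
  note end_same_curve_node[OF assms(1,2), of x]
  also note level
  also note node_gap[OF assms(1), of ?upper ?right, unfolded side]
  finally show ?thesis .
qed

lemma label_eq_same_curve:
  assumes "e \<in> ends (pretzel ps)" "f \<in> ends (pretzel ps)" "label e = label f"
  shows "same_curve e f"
proof -
  obtain i j x where e: "e = ((i, j), x)" "i < n" "j < ps ! i"
    using assms(1) by (cases e) (auto simp: ends_def pretzel_def Let_def)
  obtain i' j' y where f: "f = ((i', j'), y)" "i' < n" "j' < ps ! i'"
    using assms(2) by (cases f) (auto simp: ends_def pretzel_def Let_def)
  let ?c = "caps i (height j x)" and ?c' = "caps i' (height j' y)"
  have le: "height j x \<le> ps ! i" "height j' y \<le> ps ! i'" "gap_index i x \<le> n" "gap_index i' y \<le> n"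
    using e(2,3) f(2,3) by (cases x; cases y; auto)+
  show ?thesis
  proof (cases "0 < ?c \<and> ?c < col_caps i")
    case True
    then have eq: "i' = i" "?c' = ?c"
      using assms(3) e f by (auto simp: Let_def split: if_splits)
    then have "same_curve (node i (height j x) (x \<in> {UR, LR})) (node i (height j' y) (x \<in> {UR, LR}))"
      using le e(2) by (intro same_caps_same_curve) auto
    moreover have "same_curve (node i (height j' y) (x \<in> {UR, LR})) (node i (height j' y) (y \<in> {UR, LR}))"
      using True le e(2) eq by (intro sides_same_curve) auto
    ultimately show ?thesis
      using end_same_curve_node[OF e(2,3), of x] end_same_curve_node[OF f(2,3), of y] eq(1) e(1) f(1)
      by (metis same_curve_sym same_curve_trans)
  next
    case False
    then have False': "\<not> (0 < ?c' \<and> ?c' < col_caps i')"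
      using assms(3) e f by (auto simp: Let_def split: if_splits)
    note outer = outer_end_same_curve_gap[OF e(2,3) False] outer_end_same_curve_gap[OF f(2,3) False']
    have "same_curve (gap (?c \<noteq> 0) (gap_index i x)) (gap (?c' \<noteq> 0) (gap_index i' y))"
    proof (cases "through n = 0")
      case True
      then have "(?c \<noteq> 0) = (?c' \<noteq> 0)"
        using assms(3) e f False False' by (auto simp: of_bool_def split: if_splits)
      then show ?thesis
        using le(3,4) through_le True by (auto intro!: same_through_same_curve)
    next
      case nz: False
      let ?t = "through (gap_index i x) mod through n"
      have t: "through (gap_index i' y) mod through n = ?t"
        using assms(3) e f False False' nz by (auto simp: Let_def split: if_splits)
      have "?t < num_below (\<lambda>i. col_caps i = 0) n"
        using nz by (simp flip: through_def)
      then obtain l where "l < n" "col_caps l = 0" "through l = ?t"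
        by (elim num_below_attained) (auto simp: through_def)
      then show ?thesis
        using gap_same_curve_through_column[OF le(3), of l _ True] gap_same_curve_through_column[OF le(4), of l _ True] t
        by (metis same_curve_sym same_curve_trans)
    qed
    then show ?thesis
      using outer e(1) f(1) by (metis same_curve_sym same_curve_trans)
  qed
qed

subsection \<open>The number of labels\<close>

lemma label_image:
  "label ` ends (pretzel ps) =
     (SIGMA i:{..<n}. {0<..<col_caps i}) \<union> {..<if through n = 0 then 2 else through n} \<times> {0}"
  (is "?L = ?I \<union> ?O")
proof
  show "?L \<subseteq> ?I \<union> ?O"
  proof (rule image_subsetI)
    fix e
    assume "e \<in> ends (pretzel ps)"
    then obtain i j x where "e = ((i, j), x)" "i < n"
      by (cases e) (auto simp: ends_def pretzel_def Let_def)
    then show "label e \<in> ?I \<union> ?O"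
      by (simp add: Let_def of_bool_def)
  qed
next
  have end_in: "((i, j), x) \<in> ends (pretzel ps)" if "i < n" "j < ps ! i" for i j x
    using that by (auto simp: ends_def pretzel_def Let_def)
  have "(i, c) \<in> ?L" if "i < n" "0 < c" "c < col_caps i" for i c
  proof -
    have "c < num_below (\<lambda>j. s (i, j) \<noteq> 1) (ps ! i)" using that by (simp add: caps_def)
    then obtain j where "j < ps ! i" "caps i j = c"
      by (elim num_below_attained) (auto simp: caps_def)
    then have "label ((i, j), LL) = (i, c)" "((i, j), LL) \<in> ends (pretzel ps)"
      using that end_in by auto
    then show ?thesis by (metis image_eqI)
  qed
  moreover have "(c, 0) \<in> ?L" if "c < (if through n = 0 then 2 else through n)" for c
  proof (cases "through n = 0")
    case True
    have b: "label ((0, 0), LL) = (0, 0)" using True by (simp add: caps_0)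
    have "label ((0, ps ! 0 - 1), UL) = (1, 0)"
      using True p_pos[OF n_pos] col_caps_pos_if_through_0[OF True n_pos] by simp
    with b show ?thesis
      using that True end_in[OF n_pos, of 0 LL] end_in[OF n_pos, of "ps ! 0 - 1" UL] p_pos[OF n_pos]
      by (cases "c = 0") (auto intro: image_eqI[rotated])
  next
    case False
    then have "c < num_below (\<lambda>i. col_caps i = 0) n"
      using that by (simp flip: through_def)
    then obtain i where i: "i < n" "through i = c"
      by (elim num_below_attained) (auto simp: through_def)
    then have "label ((i, 0), LL) = (c, 0)"
      using False that by (simp add: caps_0)
    moreover have "((i, 0), LL) \<in> ends (pretzel ps)"
      using i p_pos end_in by auto
    ultimately show ?thesis by (metis image_eqI)
  qed
  ultimately show "?I \<union> ?O \<subseteq> ?L" by auto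
qed

text \<open>Truncated subtraction makes a column without horizontal smoothings contribute 0 to the sum.\<close>

lemma card_state_curves:
  "card (state_curves (pretzel ps) s) =
     (if through n = 0 then 2 else through n) + (\<Sum>i<n. col_caps i - 1)"
proof -
  let ?w = "if through n = 0 then 2 else through n"
  have "card (state_curves (pretzel ps) s) = card (label ` ends (pretzel ps))"
    using card_connected_components[of joins label "ends (pretzel ps)"] label_joins label_eq_same_curve
    by (simp add: state_curves_def same_curve_def joins_def Let_def)
  also have "\<dots> = card (SIGMA i:{..<n}. {0<..<col_caps i}) + card ({..<?w} \<times> {0 :: nat})"
    unfolding label_image by (intro card_Un_disjoint) auto
  also have "card (SIGMA i:{..<n}. {0<..<col_caps i}) = (\<Sum>i<n. col_caps i - 1)"
    by (subst card_SigmaI) auto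
  finally show ?thesis by simp
qed

end


section \<open>The Kauffman bracket of a pretzel diagram\<close>

lemma A_pow_add: "A_pow (a + b) = A_pow a * A_pow b"
  by (simp add: A_pow_def mult_single)

lemma A_pow_0: "A_pow 0 = 1"
  by (simp add: A_pow_def)

lemma A_pow_power: "A_pow a ^ m = A_pow (a * int m)"
  by (induction m) (simp_all add: A_pow_0 A_pow_add algebra_simps)

lemma A_pow_sum: "finite I \<Longrightarrow> A_pow (\<Sum>i\<in>I. f i) = (\<Prod>i\<in>I. A_pow (f i))"
  by (induction I rule: finite_induct) (simp_all add: A_pow_0 A_pow_add)

definition loop :: laurent where
  "loop = - A_pow 2 - A_pow (-2)"

lemma loop_nonzero: "loop \<noteq> 0"
proof
  assume "loop = 0"
  then have "Poly_Mapping.lookup loop 2 = 0" by simp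
  then show False by (simp add: loop_def A_pow_def lookup_minus lookup_single)
qed

text \<open>
  The state sum of a single column, where \<open>w b\<close> is the weight of a state with \<open>b\<close> horizontal smoothings.
  In \<open>capped_sum\<close> only states with a horizontal smoothing count, and \<open>b\<close> of them leave \<open>b - 1\<close> small
  loops. The value of \<open>closed_sum\<close> is the bracket of the closure of the column that joins the two left
  ends to each other and the two right ends to each other: two vertical strands close up to 2 curves
  and \<open>b\<close> horizontal smoothings to \<open>b\<close> curves, one of which the bracket does not count.
\<close>

definition tangle_sum :: "(nat \<Rightarrow> laurent) \<Rightarrow> nat \<Rightarrow> laurent" where
  "tangle_sum w p =
     (\<Sum>t\<in>{..<p} \<rightarrow>\<^sub>E {1, -1}. A_pow (\<Sum>j<p. t j) * w (num_below (\<lambda>j. t j \<noteq> 1) p))"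

definition capped_sum :: "nat \<Rightarrow> laurent" where
  "capped_sum = tangle_sum (\<lambda>b. if b = 0 then 0 else loop ^ (b - 1))"

definition closed_sum :: "nat \<Rightarrow> laurent" where
  "closed_sum = tangle_sum (\<lambda>b. if b = 0 then loop else loop ^ (b - 1))"

text \<open>
  A multiplicative weight makes the crossings independent. The weights in \<open>capped_sum\<close> and
  \<open>closed_sum\<close> are, up to the factor \<open>loop\<close>, combinations of \<open>loop ^ b\<close> and \<open>0 ^ b\<close>, the latter
  being the indicator of \<open>b = 0\<close>.
\<close>

lemma tangle_sum_power:
  "tangle_sum (\<lambda>b. x ^ b) p = (A_pow 1 + A_pow (-1) * x) ^ p"
proof -
  have "tangle_sum (\<lambda>b. x ^ b) p =
      (\<Sum>t\<in>{..<p} \<rightarrow>\<^sub>E {1, -1}. \<Prod>j<p. A_pow (t j) * x ^ of_bool (t j \<noteq> 1))"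
    by (simp add: tangle_sum_def A_pow_sum num_below_eq_sum power_sum prod.distrib del: sum_of_bool_eq)
  also have "\<dots> = (\<Prod>j<p. \<Sum>\<epsilon>\<in>{1, -1}. A_pow \<epsilon> * x ^ of_bool (\<epsilon> \<noteq> 1))"
    by (subst prod_sum_PiE) auto
  finally show ?thesis by simp
qed

lemma tangle_sum_diff: "tangle_sum v p - tangle_sum w p = tangle_sum (\<lambda>b. v b - w b) p"
  by (simp add: tangle_sum_def sum_subtractf algebra_simps)

lemma tangle_sum_mult: "x * tangle_sum w p = tangle_sum (\<lambda>b. x * w b) p"
  by (simp add: tangle_sum_def sum_distrib_left algebra_simps)

lemma loop_times_capped_sum:
  "loop * capped_sum p = (- A_pow (-3)) ^ p - A_pow p"
proof -
  have "loop * capped_sum p = tangle_sum (\<lambda>b. loop ^ b - 0 ^ b) p"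
    unfolding capped_sum_def tangle_sum_mult
    by (rule arg_cong[where f = "\<lambda>w. tangle_sum w p"]) (auto simp: fun_eq_iff power_eq_if)
  also have "\<dots> = (A_pow 1 + A_pow (-1) * loop) ^ p - A_pow 1 ^ p"
    by (simp flip: tangle_sum_diff add: tangle_sum_power)
  also have "A_pow 1 + A_pow (-1) * loop = - A_pow (-3)"
    by (simp add: loop_def algebra_simps flip: A_pow_add)
  finally show ?thesis by (simp add: A_pow_power)
qed

lemma closed_sum_eq: "closed_sum p = capped_sum p + loop * A_pow p"
proof -
  have "closed_sum p - capped_sum p = tangle_sum (\<lambda>b. loop * 0 ^ b) p"
    unfolding closed_sum_def capped_sum_def tangle_sum_diff
    by (rule arg_cong[where f = "\<lambda>w. tangle_sum w p"]) (auto simp: fun_eq_iff)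
  also have "\<dots> = loop * A_pow p"
    by (simp flip: tangle_sum_mult add: tangle_sum_power A_pow_power)
  finally show ?thesis by (simp add: algebra_simps)
qed

lemma capped_sum_1: "capped_sum 1 = A_pow (-1)"
proof -
  have "loop * capped_sum 1 = loop * A_pow (-1)"
    unfolding loop_times_capped_sum by (simp add: loop_def algebra_simps flip: A_pow_add)
  then show ?thesis using loop_nonzero by simp
qed

lemma closed_sum_1: "closed_sum 1 = - A_pow 3"
  unfolding closed_sum_eq capped_sum_1 by (simp add: loop_def algebra_simps flip: A_pow_add)

text \<open>Currying turns a state of a diagram into a family of states of its columns.\<close>

lemma sum_PiE_Sigma:
  fixes F :: "'a \<Rightarrow> ('b \<Rightarrow> 'c) \<Rightarrow> 'd :: comm_semiring_1"
  assumes "finite I" "\<And>i. i \<in> I \<Longrightarrow> finite (J i)" "finite X"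
  shows "(\<Sum>s\<in>Sigma I J \<rightarrow>\<^sub>E X. \<Prod>i\<in>I. F i (\<lambda>j\<in>J i. s (i, j))) =
    (\<Prod>i\<in>I. \<Sum>t\<in>J i \<rightarrow>\<^sub>E X. F i t)"
proof -
  have "(\<Prod>i\<in>I. \<Sum>t\<in>J i \<rightarrow>\<^sub>E X. F i t) = (\<Sum>g\<in>(\<Pi>\<^sub>E i\<in>I. J i \<rightarrow>\<^sub>E X). \<Prod>i\<in>I. F i (g i))"
    using assms by (intro prod_sum_PiE) (auto intro: finite_PiE)
  also have "\<dots> = (\<Sum>s\<in>Sigma I J \<rightarrow>\<^sub>E X. \<Prod>i\<in>I. F i (\<lambda>j\<in>J i. s (i, j)))"
  proof (rule sum.reindex_bij_witness[where
        i = "\<lambda>s. \<lambda>i\<in>I. \<lambda>j\<in>J i. s (i, j)" and j = "\<lambda>g. \<lambda>(i, j)\<in>Sigma I J. g i j"])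
    fix g assume g: "g \<in> (\<Pi>\<^sub>E i\<in>I. J i \<rightarrow>\<^sub>E X)"
    have col: "(\<lambda>j\<in>J i. (\<lambda>(i, j)\<in>Sigma I J. g i j) (i, j)) = g i" if "i \<in> I" for i
    proof -
      have "(\<lambda>j\<in>J i. (\<lambda>(i, j)\<in>Sigma I J. g i j) (i, j)) = restrict (g i) (J i)"
        using that by (auto simp: restrict_def fun_eq_iff)
      also have "\<dots> = g i"
        using PiE_mem[OF g that] by (rule PiE_restrict)
      finally show ?thesis .
    qed
    show "(\<lambda>i\<in>I. \<lambda>j\<in>J i. (\<lambda>(i, j)\<in>Sigma I J. g i j) (i, j)) = g"
      using col PiE_restrict[OF g] by (metis (no_types, lifting) restrict_ext)
    show "(\<lambda>(i, j)\<in>Sigma I J. g i j) \<in> Sigma I J \<rightarrow>\<^sub>E X"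
      using g by (fastforce simp: PiE_iff extensional_def)
    show "(\<Prod>i\<in>I. F i (\<lambda>j\<in>J i. (\<lambda>(i, j)\<in>Sigma I J. g i j) (i, j))) = (\<Prod>i\<in>I. F i (g i))"
      by (intro prod.cong refl arg_cong[where f = "F _"] col)
  next
    fix s assume s: "s \<in> Sigma I J \<rightarrow>\<^sub>E X"
    then show "(\<lambda>i\<in>I. \<lambda>j\<in>J i. s (i, j)) \<in> (\<Pi>\<^sub>E i\<in>I. J i \<rightarrow>\<^sub>E X)"
      by (auto simp: PiE_iff)
    show "(\<lambda>(i, j)\<in>Sigma I J. (\<lambda>i\<in>I. \<lambda>j\<in>J i. s (i, j)) i j) = s"
      using s by (auto simp: fun_eq_iff restrict_def PiE_iff extensional_def)
  qed
  finally show ?thesis ..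
qed

lemma num_below_cong: "(\<And>j. j < n \<Longrightarrow> P j = Q j) \<Longrightarrow> num_below P n = num_below Q n"
  by (induction n) auto

context pretzel_state
begin

text \<open>
  The first product gives the exponent \<open>v\<close> to the curves outside the small loops, where \<open>v\<close> is the number of
  columns of two vertical strands. It is right unless \<open>v = 0\<close>, when the exponent should be 2
  instead of 0; the second product vanishes unless \<open>v = 0\<close>, and then the two are equal.
\<close>

lemma loop_power_card_state_curves:
  "loop ^ card (state_curves (pretzel ps) s) =
     (\<Prod>i<n. if col_caps i = 0 then loop else loop ^ (col_caps i - 1)) +
     (loop\<^sup>2 - 1) * (\<Prod>i<n. if col_caps i = 0 then 0 else loop ^ (col_caps i - 1))"
proof -
  let ?inner = "\<Sum>i<n. col_caps i - 1"
  have "(\<Prod>i<n. if col_caps i = 0 then loop else loop ^ (col_caps i - 1)) =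
      (\<Prod>i<n. loop ^ of_bool (col_caps i = 0) * loop ^ (col_caps i - 1))"
    by (intro prod.cong) auto
  then have closed: "(\<Prod>i<n. if col_caps i = 0 then loop else loop ^ (col_caps i - 1)) =
      loop ^ through n * loop ^ ?inner"
    by (simp add: through_def num_below_eq_sum prod.distrib power_sum del: sum_of_bool_eq)
  show ?thesis
  proof (cases "through n = 0")
    case True
    then have "(\<Prod>i<n. if col_caps i = 0 then 0 else loop ^ (col_caps i - 1)) =
        (\<Prod>i<n. loop ^ (col_caps i - 1))"
      using col_caps_pos_if_through_0 by (intro prod.cong) auto
    then have "(\<Prod>i<n. if col_caps i = 0 then 0 else loop ^ (col_caps i - 1)) = loop ^ ?inner"
      by (simp add: power_sum)
    then show ?thesis
      unfolding card_state_curves closed using True by (simp add: algebra_simps power_add power2_eq_square)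
  next
    case False
    then obtain i where i: "i < n" "col_caps i = 0"
      using num_below_pos_iff[of "\<lambda>i. col_caps i = 0" n] by (auto simp: through_def)
    then have "(\<Prod>i<n. if col_caps i = 0 then 0 else loop ^ (col_caps i - 1)) = 0"
      by (intro prod_zero bexI[of _ i]) auto
    then show ?thesis
      unfolding card_state_curves closed using False by (simp add: power_add)
  qed
qed

lemma card_state_curves_pos: "0 < card (state_curves (pretzel ps) s)"
  by (simp add: card_state_curves)

end

lemma sum_states_pretzel:
  "(\<Sum>s\<in>states (pretzel ps). A_pow (\<Sum>c\<in>crossings (pretzel ps). s c) *
      (\<Prod>i<length ps. w (num_below (\<lambda>j. s (i, j) \<noteq> 1) (ps ! i)))) =
    (\<Prod>i<length ps. tangle_sum w (ps ! i))"
proof -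
  let ?n = "length ps"
  define F where "F i t = A_pow (\<Sum>j<ps ! i. t j) * w (num_below (\<lambda>j. t j \<noteq> 1) (ps ! i))"
    for i and t :: "nat \<Rightarrow> int"
  have "A_pow (\<Sum>c\<in>crossings (pretzel ps). s c) *
      (\<Prod>i<?n. w (num_below (\<lambda>j. s (i, j) \<noteq> 1) (ps ! i))) =
      (\<Prod>i<?n. F i (\<lambda>j\<in>{..<ps ! i}. s (i, j)))" for s
  proof -
    have "(\<Sum>c\<in>crossings (pretzel ps). s c) = (\<Sum>i<?n. \<Sum>j<ps ! i. s (i, j))"
      by (simp add: crossings_pretzel sum.Sigma)
    moreover have "num_below (\<lambda>j. (\<lambda>j\<in>{..<ps ! i}. s (i, j)) j \<noteq> 1) (ps ! i) =
        num_below (\<lambda>j. s (i, j) \<noteq> 1) (ps ! i)" for i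
      by (intro num_below_cong) auto
    ultimately show ?thesis
      by (simp add: F_def A_pow_sum prod.distrib)
  qed
  then show ?thesis
    using sum_PiE_Sigma[of "{..<?n}" "\<lambda>i. {..<ps ! i}" "{1, -1}" F]
    by (simp add: states_def crossings_pretzel tangle_sum_def F_def)
qed

lemma loop_times_kauffman_bracket_pretzel:
  assumes "ps \<noteq> []" and "\<And>p. p \<in> set ps \<Longrightarrow> 0 < p"
  shows "loop * kauffman_bracket (pretzel ps) =
    prod_list (map closed_sum ps) + (loop\<^sup>2 - 1) * prod_list (map capped_sum ps)"
proof -
  let ?D = "pretzel ps" and ?n = "length ps"
  let ?A = "\<lambda>s. A_pow (\<Sum>c\<in>crossings ?D. s c)"
  let ?P = "\<lambda>w s. \<Prod>i<?n. w (num_below (\<lambda>j. s (i, j) \<noteq> 1) (ps ! i)) :: laurent"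
  define closed :: "nat \<Rightarrow> laurent" where "closed b = (if b = 0 then loop else loop ^ (b - 1))" for b
  define capped :: "nat \<Rightarrow> laurent" where "capped b = (if b = 0 then 0 else loop ^ (b - 1))" for b
  have state: "loop * (?A s * loop ^ (card (state_curves ?D s) - 1)) =
      ?A s * ?P closed s + (loop\<^sup>2 - 1) * (?A s * ?P capped s)" for s
  proof -
    interpret pretzel_state ps s using assms by unfold_locales
    have "loop * (?A s * loop ^ (card (state_curves ?D s) - 1)) =
        ?A s * loop ^ card (state_curves ?D s)"
      using card_state_curves_pos by (simp add: power_eq_if mult.left_commute)
    then show ?thesis
      unfolding loop_power_card_state_curves closed_def capped_def caps_def by (simp add: algebra_simps)
  qed
  have "loop * kauffman_bracket ?D = (\<Sum>s\<in>states ?D. ?A s * ?P closed s) +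
      (loop\<^sup>2 - 1) * (\<Sum>s\<in>states ?D. ?A s * ?P capped s)"
    unfolding kauffman_bracket_def loop_def[symmetric] sum_distrib_left state
    by (simp add: sum.distrib sum_distrib_left)
  also have "\<dots> = (\<Prod>i<?n. closed_sum (ps ! i)) + (loop\<^sup>2 - 1) * (\<Prod>i<?n. capped_sum (ps ! i))"
    unfolding sum_states_pretzel by (simp add: closed_sum_def capped_sum_def closed_def[abs_def] capped_def[abs_def])
  finally show ?thesis
    by (simp add: prod.list_conv_set_nth atLeast0LessThan)
qed


section \<open>The writhe of a pretzel diagram with one even column\<close>

lemma alternating_bits:
  assumes "a \<le> b" "\<And>i. a \<le> i \<Longrightarrow> i < b \<Longrightarrow> x (Suc i) = (\<not> x i)"
  shows "x b = (x a \<noteq> odd (b - a))"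
  using assms
proof (induction b rule: dec_induct)
  case (step b)
  then show ?case by (auto simp: Suc_diff_le)
qed simp

locale oriented_pretzel = pretzel_columns +
  fixes out :: "(nat \<times> nat) strand_end \<Rightarrow> bool"
  assumes orientation: "orientation (pretzel ps) out"
begin

text \<open>
  The directions at the left ends of a column at its bottom and its top. Reading the column
  number modulo \<open>n\<close> lets the arcs around the diagram be treated like those between neighbours.
\<close>

definition bottom :: "nat \<Rightarrow> bool" where
  "bottom i = out ((i mod n, 0), LL)"

definition upper :: "nat \<Rightarrow> bool" where
  "upper i = out ((i mod n, ps ! (i mod n) - 1), UL)"

lemma crossing_out:
  assumes "i < n" "j < ps ! i"
  shows "out ((i, j), LL) = (\<not> out ((i, j), UR))" "out ((i, j), LR) = (\<not> out ((i, j), UL))"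
  using orientation assms by (auto simp: orientation_def crossings_pretzel)

lemma arc_out: "(e, f) \<in> arcs (pretzel ps) \<Longrightarrow> out f = (\<not> out e)"
  using orientation by (auto simp: orientation_def)

lemma mod_Suc_cases: "i < n \<Longrightarrow> Suc i < n \<and> Suc i mod n = Suc i \<or> n - 1 = i \<and> Suc i mod n = 0"
  by (cases "Suc i = n") auto

lemma bottom_right:
  assumes "i < n"
  shows "out ((i, 0), LR) = (\<not> bottom (Suc i))"
  using mod_Suc_cases[OF assms]
proof
  assume "Suc i < n \<and> Suc i mod n = Suc i"
  then show ?thesis
    using arc_out[of "((i, 0), LR)" "((Suc i, 0), LL)"] by (simp add: bottom_def pretzel_def Let_def)
next
  assume last: "n - 1 = i \<and> Suc i mod n = 0"
  then have "bottom (Suc i) = out ((0, 0), LL)" by (simp add: bottom_def)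
  then show ?thesis
    using last arc_out[of "((0, 0), LL)" "((i, 0), LR)"] by (simp add: pretzel_def Let_def)
qed

lemma upper_right:
  assumes "i < n"
  shows "out ((i, ps ! i - 1), UR) = (\<not> upper (Suc i))"
  using mod_Suc_cases[OF assms]
proof
  assume "Suc i < n \<and> Suc i mod n = Suc i"
  then show ?thesis
    using arc_out[of "((i, ps ! i - 1), UR)" "((Suc i, ps ! Suc i - 1), UL)"]
    by (simp add: upper_def pretzel_def Let_def)
next
  assume last: "n - 1 = i \<and> Suc i mod n = 0"
  then have "upper (Suc i) = out ((0, ps ! 0 - 1), UL)" by (simp add: upper_def)
  then show ?thesis
    using last arc_out[of "((0, ps ! 0 - 1), UL)" "((i, ps ! i - 1), UR)"]
    by (simp add: pretzel_def Let_def)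
qed

text \<open>
  Each crossing interchanges the two strands of its column, so their directions depend only on
  the parity of the height.
\<close>

lemma crossing_upper_ends:
  assumes "i < n" "j < ps ! i"
  shows "out ((i, j), UL) = (if even j then bottom (Suc i) else \<not> bottom i)
    \<and> out ((i, j), UR) = (if even j then \<not> bottom i else bottom (Suc i))"
  using assms(2)
proof (induction j)
  case 0
  then show ?case
    using crossing_out[OF assms(1), of 0] bottom_right[OF assms(1)] assms(1) by (auto simp: bottom_def)
next
  case (Suc j)
  have "out ((i, Suc j), LL) = (\<not> out ((i, j), UL))" "out ((i, Suc j), LR) = (\<not> out ((i, j), UR))"
    using Suc.prems assms(1) by (auto intro!: arc_out simp: pretzel_def Let_def)
  then show ?case
    using crossing_out[OF assms(1) Suc.prems] Suc by auto
qed

lemma crossing_sign_eq: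
  assumes "i < n" "j < ps ! i"
  shows "crossing_sign out (i, j) = (if bottom (Suc i) = bottom i then - 1 else 1)"
  using crossing_upper_ends[OF assms] by (auto simp: crossing_sign_def)

lemma writhe_eq:
  "writhe (pretzel ps) out = (\<Sum>i<n. (if bottom (Suc i) = bottom i then - 1 else 1) * int (ps ! i))"
proof -
  have "writhe (pretzel ps) out = (\<Sum>i<n. \<Sum>j<ps ! i. crossing_sign out (i, j))"
    by (simp add: writhe_def crossings_pretzel sum.Sigma)
  also have "\<dots> = (\<Sum>i<n. \<Sum>j<ps ! i. if bottom (Suc i) = bottom i then - 1 else 1)"
    by (intro sum.cong) (auto simp: crossing_sign_eq)
  finally show ?thesis by (simp add: mult.commute)
qed

lemma odd_column:
  assumes "i < n" "odd (ps ! i)"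
  shows "upper i = bottom (Suc i)" "upper (Suc i) = bottom i"
  using crossing_upper_ends[of i "ps ! i - 1"] upper_right[OF assms(1)] assms p_pos[OF assms(1)]
  by (auto simp: upper_def)

lemma even_column:
  assumes "i < n" "even (ps ! i)"
  shows "upper i = (\<not> bottom i)" "upper (Suc i) = (\<not> bottom (Suc i))"
  using crossing_upper_ends[of i "ps ! i - 1"] upper_right[OF assms(1)] assms p_pos[OF assms(1)]
  by (auto simp: upper_def)

text \<open>
  An even column forces its upper and lower left ends to have opposite directions, and likewise its right
  ends. An odd column carries this property from one side to the other, so it spreads to all
  gaps, and inside an odd column it means that the strands are parallel.
\<close>

lemma antiparallel_strands_at_gaps:
  assumes "e < n" "even (ps ! e)" "\<And>i. i < n \<Longrightarrow> i \<noteq> e \<Longrightarrow> odd (ps ! i)" "g \<le> n"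
  shows "upper g = (\<not> bottom g)"
proof (cases "g \<le> e")
  case True
  then show ?thesis
  proof (induction g rule: inc_induct)
    case base
    then show ?case using even_column assms by blast
  next
    case (step g)
    then have "g < n" "odd (ps ! g)" using assms(1,3) by auto
    then show ?case using step.IH odd_column by simp
  qed
next
  case False
  then have "Suc e \<le> g" by simp
  then show ?thesis
    using assms(4)
  proof (induction g rule: dec_induct)
    case base
    then show ?case using even_column assms by blast
  next
    case (step g)
    then have "g < n" "odd (ps ! g)" using assms(3) by auto
    then show ?case using step.IH odd_column by simp
  qed
qed

text \<open>
  Passing a column of parallel strands reverses the direction of the lower arc. Going once around, over the
  even number \<open>n - 1\<close> of odd columns, leaves no reversal for the even column, so its strands are
  antiparallel and its crossings negative.
\<close>

lemma writhe_one_even_column: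
  assumes e: "e < n" "even (ps ! e)" and odd: "\<And>i. i < n \<Longrightarrow> i \<noteq> e \<Longrightarrow> odd (ps ! i)"
    and "odd n"
  shows "writhe (pretzel ps) out = int (sum_list ps) - 2 * int (ps ! e)"
proof -
  have flip: "bottom (Suc i) = (\<not> bottom i)" if "i < n" "i \<noteq> e" for i
    using odd_column[of i] antiparallel_strands_at_gaps[OF e odd, of i] odd that by simp
  have "bottom e = (bottom 0 \<noteq> odd e)"
    using alternating_bits[of 0 e bottom] flip e(1) by simp
  moreover have "bottom n = (bottom (Suc e) \<noteq> odd (n - Suc e))"
    using e(1) flip by (intro alternating_bits) auto
  moreover have "bottom n = bottom 0"
    by (simp add: bottom_def)
  moreover have "odd (n - Suc e) = odd e"
    using e(1) \<open>odd n\<close> by (simp add: even_diff_nat)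
  ultimately have keep: "bottom (Suc e) = bottom e"
    by auto
  have "writhe (pretzel ps) out = (\<Sum>i<n. int (ps ! i) - (if i = e then 2 * int (ps ! e) else 0))"
    unfolding writhe_eq using flip keep by (intro sum.cong) auto
  also have "\<dots> = (\<Sum>i<n. int (ps ! i)) - 2 * int (ps ! e)"
    using e(1) by (simp add: sum_subtractf sum.delta)
  also have "(\<Sum>i<n. int (ps ! i)) = int (sum_list ps)"
    by (simp add: sum_list_sum_nth atLeast0LessThan)
  finally show ?thesis .
qed

end


section \<open>The two families\<close>

lemma writhe_pretzel_ones:
  assumes "orientation (pretzel_ones m [a, b, c]) out"
    and "even m" "even a" "0 < a" "odd b" "odd c"
  shows "writhe (pretzel_ones m [a, b, c]) out = int m - int a + int b + int c"
proof -
  define ps where "ps = replicate m 1 @ [a, b, c]"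
  interpret oriented_pretzel ps out
    using assms by unfold_locales (auto simp: ps_def pretzel_ones_def odd_pos)
  have nth: "ps ! m = a" by (simp add: ps_def nth_append)
  have "odd (ps ! i)" if "i < length ps" "i \<noteq> m" for i
  proof -
    have "ps ! i \<in> {1, b, c}"
      using that by (auto simp: ps_def nth_append nth_Cons split: nat.splits)
    then show ?thesis using assms(5,6) by auto
  qed
  moreover have "odd (length ps)" using assms(2) by (simp add: ps_def)
  ultimately have "writhe (pretzel ps) out = int (sum_list ps) - 2 * int (ps ! m)"
    using assms(3) nth by (intro writhe_one_even_column) (auto simp: ps_def)
  then show ?thesis
    unfolding nth by (simp add: ps_def pretzel_ones_def sum_list_replicate)
qed

text \<open>
  The factor \<open>loop ^ 4\<close> clears the denominators of the three long columns and of the bracket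
  formula. The \<open>m\<close> columns with one crossing contribute \<open>(-A\<^sup>3)\<^sup>m\<close> and \<open>A\<^sup>-\<^sup>m\<close>; for even \<open>m\<close> the sign disappears.
\<close>

lemma loop_power_4_times_kauffman_bracket:
  fixes a b c m :: nat
  defines "v p \<equiv> (- A_pow (-3)) ^ p"
  defines "d \<equiv> loop\<^sup>2 - 1"
  assumes "even m" "0 < a" "0 < b" "0 < c"
  shows "loop ^ 4 * kauffman_bracket (pretzel_ones m [a, b, c]) =
    A_pow (3 * int m) * ((v a + d * A_pow a) * (v b + d * A_pow b) * (v c + d * A_pow c)) +
    d * A_pow (- int m) * ((v a - A_pow a) * (v b - A_pow b) * (v c - A_pow c))"
proof -
  have br: "loop * kauffman_bracket (pretzel_ones m [a, b, c]) =
      A_pow (3 * int m) * (closed_sum a * closed_sum b * closed_sum c) +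
      d * A_pow (- int m) * (capped_sum a * capped_sum b * capped_sum c)"
    unfolding pretzel_ones_def d_def
    by (subst loop_times_kauffman_bracket_pretzel)
      (use assms in \<open>auto simp: closed_sum_1[simplified] capped_sum_1[simplified] prod_list_replicate A_pow_power algebra_simps\<close>)
  have u: "loop * capped_sum p = v p - A_pow p" for p
    by (simp add: v_def loop_times_capped_sum)
  have w: "loop * closed_sum p = v p + d * A_pow p" for p
    by (simp add: closed_sum_eq distrib_left u d_def power2_eq_square left_diff_distrib mult.assoc)
  have "loop ^ 4 * kauffman_bracket (pretzel_ones m [a, b, c]) =
      loop ^ 3 * (loop * kauffman_bracket (pretzel_ones m [a, b, c]))"
    by (simp add: power_numeral_reduce mult.assoc)
  also have "\<dots> = A_pow (3 * int m) * ((loop * closed_sum a) * (loop * closed_sum b) * (loop * closed_sum c)) +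
      d * A_pow (- int m) * ((loop * capped_sum a) * (loop * capped_sum b) * (loop * capped_sum c))"
    unfolding br by (simp add: algebra_simps power3_eq_cube)
  finally show ?thesis unfolding u w .
qed

text \<open>
  Laurent polynomials form an integral domain, so it suffices to compare the multiples by \<open>loop ^ 4\<close>.
  As \<open>k\<close> is even, all signs are explicit, and both sides expand into signed powers of \<open>A\<close> with exponents
  linear in \<open>k\<close>.
\<close>

lemma kauffman_bracket_relation:
  assumes "even k"
  shows "kauffman_bracket (pretzel_ones (k + 6) [k + 2, k + 1, k + 3]) =
    A_pow 12 * kauffman_bracket (pretzel_ones k [k + 4, k + 3, k + 5])"
proof -
  have pow: "(- A_pow (-3)) ^ (k + j) = (-1) ^ j * A_pow (- 3 * int k - 3 * int j)" for j
  proof -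
    have "(- A_pow (-3)) ^ (k + j) = (-1) ^ (k + j) * A_pow (-3) ^ (k + j)"
      by (rule power_minus)
    also have "(-1 :: laurent) ^ (k + j) = (-1) ^ j"
      using assms by (simp add: power_add)
    also have "A_pow (-3) ^ (k + j) = A_pow (- 3 * int k - 3 * int j)"
      unfolding A_pow_power by (rule arg_cong[where f = A_pow]) simp
    finally show ?thesis .
  qed
  \<comment> \<open>The unit is written as a power of \<open>A\<close> so that the expansion consists of products of powers only.\<close>
  have d: "loop\<^sup>2 - 1 = A_pow 4 + A_pow 0 + A_pow (-4)"
    by (simp add: loop_def power2_eq_square algebra_simps A_pow_0 flip: A_pow_add)
  have pos: "0 < k + 1" "0 < k + 2" "0 < k + 3" "0 < k + 4" "0 < k + 5" by simp_all
  have even6: "even (k + 6)" using assms by simp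
  have "loop ^ 4 * kauffman_bracket (pretzel_ones (k + 6) [k + 2, k + 1, k + 3]) =
      A_pow 12 * (loop ^ 4 * kauffman_bracket (pretzel_ones k [k + 4, k + 3, k + 5]))"
    unfolding
      loop_power_4_times_kauffman_bracket[OF even6 pos(2) pos(1) pos(3)]
      loop_power_4_times_kauffman_bracket[OF assms pos(4) pos(3) pos(5)]
    unfolding pow d
    by (simp only: distrib_left distrib_right left_diff_distrib right_diff_distrib mult.assoc
        of_nat_add flip: A_pow_add)
      (simp add: algebra_simps minus_diff_commute flip: A_pow_add)
  then show ?thesis using loop_nonzero by (simp add: mult.left_commute)
qed

theorem theorem1p2:
  fixes k :: nat
    and out1 out2 :: "(nat \<times> nat) strand_end \<Rightarrow> bool"
  assumes "even k"
    and "orientation (pretzel_ones k [k + 4, k + 3, k + 5]) out1"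
    and "orientation (pretzel_ones (k + 6) [k + 2, k + 1, k + 3]) out2"
  shows "jones (pretzel_ones k [k + 4, k + 3, k + 5]) out1
       = jones (pretzel_ones (k + 6) [k + 2, k + 1, k + 3]) out2"
proof -
  have w1: "writhe (pretzel_ones k [k + 4, k + 3, k + 5]) out1 = 2 * int k + 4"
    using writhe_pretzel_ones[OF assms(2)] assms(1) by simp
  have w2: "writhe (pretzel_ones (k + 6) [k + 2, k + 1, k + 3]) out2 = 2 * int k + 8"
    using writhe_pretzel_ones[OF assms(3)] assms(1) by simp
  have "minus_A_pow (-3 * (2 * int k + 4)) = minus_A_pow (-3 * (2 * int k + 8)) * A_pow 12"
    by (simp add: minus_A_pow_def algebra_simps flip: A_pow_add)
  then have "normalized_bracket (pretzel_ones k [k + 4, k + 3, k + 5]) out1 =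
      normalized_bracket (pretzel_ones (k + 6) [k + 2, k + 1, k + 3]) out2"
    unfolding normalized_bracket_def w1 w2 kauffman_bracket_relation[OF assms(1)]
    by (simp add: mult.assoc)
  then show ?thesis by (simp add: jones_def)
qed

end
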